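(* Let $\mathcal{Z}$ be a measurable space, $P$ a probability distribution on $\mathcal{Z}\times\mathcal{Z}$, $\mu$ a $\sigma$-finite base measure on $\mathcal{Z}$, and $Q$ an ensembling channel on $\mathcal{Z}$ such that $Q(\cdot\mid z)$ has a density with respect to $\mu$ for every $z\in\mathcal{Z}$. Then for any (measurable) $\mathcal{A}:\mathcal{Z}\to[0,1]$, \[\beta^2_P(\mathcal{A}_Q)\leq \frac14\,\|T_{P,Q}\|_{L_\infty\to L_1}.\]
   Context: An ensembling channel $Q$ is a Markov kernel on $\mathcal{Z}$: for each $z\in\mathcal{Z}$, $Q(\cdot\mid z)$ is a probability distribution on $\mathcal{Z}$. Its density with respect to $\mu$ is also denoted $Q(\cdot\mid z)$, and the map $(w,z)\mapsto Q(w\mid z)$ is taken jointly measurable. The ensembled algorithm is $\mathcal{A}_Q(z)=\mathbb{E}_{Z'\sim Q(\cdot\mid z)}[\mathcal{A}(Z')]$. For an algorithm $\mathcal{B}:\mathcal{Z}\to[0,1]$, the stability parameter is $\beta_P^2(\mathcal{B})=\mathbb{E}_{(Z,Z')\sim P}\big[(\mathcal{B}(Z)-\mathcal{B}(Z'))^2\big]$. The kernel is \[K_{P,Q}(z,z')=\mathbb{E}_{(Z_0,Z_1)\sim P}\big[(Q(z\mid Z_0)-Q(z\mid Z_1))\,(Q(z'\mid Z_0)-Q(z'\mid Z_1))\big],\] and for bounded measurable $f:\mathcal{Z}\to\mathbb{R}$, $[T_{P,Q}f](z)=\int_{\mathcal{Z}}K_{P,Q}(z,z')f(z')\,d\mu(z')$.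 The operator norm is $\|T_{P,Q}\|_{L_\infty\to L_1}=\sup\{\|T_{P,Q}f\|_{L_1}: f \text{ measurable},\ \|f\|_{L_\infty}\leq 1\}$, where $\|f\|_{L_1}=\int_{\mathcal{Z}}|f(z)|\,d\mu(z)$ and $\|f\|_{L_\infty}=\sup_{z\in\mathcal{Z}}|f(z)|$. *)

theory Defs
  imports "HOL-Probability.Probability"
begin

text \<open>
  The base measure \<open>\<mu>\<close> carries the underlying measurable space: the domain is \<open>space \<mu>\<close> with
  \<open>\<sigma>\<close>-algebra \<open>sets \<mu>\<close>. A channel is given by its kernel \<open>Q\<close> (so that \<open>Q z\<close> is a measure)
  and by densities \<open>q\<close>, where \<open>q w z\<close> stands for \<open>Q(w | z)\<close>: the outcome comes first, the
  conditioning point second.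
\<close>

definition ensembled :: "('a \<Rightarrow> 'a measure) \<Rightarrow> ('a \<Rightarrow> real) \<Rightarrow> 'a \<Rightarrow> real"
  where "ensembled Q A z = (LINT z'|Q z. A z')"

text \<open>This is the squared quantity \<open>\<beta>\<^sub>P\<^sup>2(B)\<close>.\<close>

definition stability_sq :: "('a \<times> 'a) measure \<Rightarrow> ('a \<Rightarrow> real) \<Rightarrow> real"
  where "stability_sq P B = (LINT (z, z')|P. (B z - B z')\<^sup>2)"

text \<open>
  If the densities \<open>q\<close> are jointly measurable, the integrand defining the kernel is integrable for
  almost every \<open>(z, z')\<close> only, and similarly for the operator below; on the exceptional null sets
  the Bochner integral takes the value 0.
\<close>

definition channel_kernel ::
  "('a \<times> 'a) measure \<Rightarrow> ('a \<Rightarrow> 'a \<Rightarrow> real) \<Rightarrow> 'a \<Rightarrow> 'a \<Rightarrow> real"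
  where "channel_kernel P q z z' =
    (LINT (z0, z1)|P. (q z z0 - q z z1) * (q z' z0 - q z' z1))"

definition channel_operator ::
  "'a measure \<Rightarrow> ('a \<times> 'a) measure \<Rightarrow> ('a \<Rightarrow> 'a \<Rightarrow> real) \<Rightarrow> ('a \<Rightarrow> real) \<Rightarrow> 'a \<Rightarrow> real"
  where "channel_operator \<mu> P q f z = (LINT z'|\<mu>. channel_kernel P q z z' * f z')"

text \<open>
  The norms take values in \<open>[0, \<infinity>]\<close>, so non-integrable functions and unbounded suprema get the
  value \<open>\<infinity>\<close>. The \<open>L\<^sub>\<infinity>\<close> norm is the pointwise supremum, not the essential one.
\<close>

definition L1_norm :: "'a measure \<Rightarrow> ('a \<Rightarrow> real) \<Rightarrow> ennreal"
  where "L1_norm \<mu> f = (\<integral>\<^sup>+ z. ennreal \<bar>f z\<bar> \<partial>\<mu>)"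

definition Linf_norm :: "'a measure \<Rightarrow> ('a \<Rightarrow> real) \<Rightarrow> ennreal"
  where "Linf_norm \<mu> f = (SUP z\<in>space \<mu>. ennreal \<bar>f z\<bar>)"

definition Linf_L1_opnorm :: "'a measure \<Rightarrow> (('a \<Rightarrow> real) \<Rightarrow> 'a \<Rightarrow> real) \<Rightarrow> ennreal"
  where "Linf_L1_opnorm \<mu> T =
    (SUP f\<in>{f \<in> borel_measurable \<mu>. Linf_norm \<mu> f \<le> 1}. L1_norm \<mu> (T f))"

end

theory Submission
  imports Defs
begin

text \<open>
  Write \<open>d z (z\<^sub>0, z\<^sub>1) = q z z\<^sub>0 - q z z\<^sub>1\<close> and \<open>f = 2 A - 1\<close>, so that \<open>f\<close> takes values in
  \<open>[-1, 1]\<close>. Both \<open>Q(\<cdot> | z\<^sub>0)\<close> and \<open>Q(\<cdot> | z\<^sub>1)\<close> have mass 1, so \<open>d \<cdot> (z\<^sub>0, z\<^sub>1)\<close> integrates to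
  0 and replacing \<open>A\<close> by its centred version gains a factor of two:
  \<open>A\<^sub>Q z\<^sub>0 - A\<^sub>Q z\<^sub>1 = 1/2 \<integral> f z * d z (z\<^sub>0, z\<^sub>1) d\<mu>(z)\<close>; this is where the constant
  \<open>1/4\<close> comes from. Squaring and averaging over \<open>P\<close>, Fubini's theorem gives the quadratic form
  \<open>\<beta>\<^sub>P\<^sup>2(A\<^sub>Q) = 1/4 \<integral> f * T\<^sub>P\<^sub>Q f d\<mu>\<close>, which is at most \<open>1/4\<close> times the \<open>L\<^sub>1\<close> norm of \<open>T\<^sub>P\<^sub>Q f\<close>,
  and \<open>f\<close> competes in the supremum defining the operator norm.

  The interchange of integrals is legitimate because \<open>\<integral> \<bar>d z p\<bar> d\<mu>(z) \<le> 2\<close> for all \<open>p\<close>; it is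
  carried out in \<open>second_moment_Fubini\<close> for general signed kernels, and the estimate by
  the \<open>L\<^sub>1\<close> norm is \<open>second_moment_le_L1_norm\<close>.
\<close>

lemma second_moment_Fubini:
  fixes e :: "'a \<Rightarrow> 'b \<Rightarrow> real"
  assumes "sigma_finite_measure \<mu>" and "finite_measure P"
    and e [measurable]: "(\<lambda>(z, p). e z p) \<in> borel_measurable (\<mu> \<Otimes>\<^sub>M P)"
    and bound: "\<And>p. p \<in> space P \<Longrightarrow> (\<integral>\<^sup>+ z. ennreal \<bar>e z p\<bar> \<partial>\<mu>) \<le> ennreal C"
  shows "(LINT p|P. (LINT z|\<mu>. e z p)\<^sup>2) = (LINT z|\<mu>. LINT z'|\<mu>. LINT p|P. e z p * e z' p)"
    and "integrable \<mu> (\<lambda>z. LINT z'|\<mu>. LINT p|P. e z p * e z' p)"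
proof -
  interpret mu: sigma_finite_measure \<mu> by fact
  interpret P: finite_measure P by fact
  interpret mm: pair_sigma_finite \<mu> \<mu> by unfold_locales
  interpret PN: pair_sigma_finite P "\<mu> \<Otimes>\<^sub>M \<mu>" by unfold_locales
  define g where "g = (\<lambda>p (y :: 'a \<times> 'a). e (fst y) p * e (snd y) p)"
  have g_meas [measurable]: "case_prod g \<in> borel_measurable (P \<Otimes>\<^sub>M (\<mu> \<Otimes>\<^sub>M \<mu>))"
    unfolding g_def by measurable
  have inner: "(\<integral>\<^sup>+ y. ennreal \<bar>g p y\<bar> \<partial>(\<mu> \<Otimes>\<^sub>M \<mu>)) \<le> ennreal C * ennreal C"
    if p [measurable]: "p \<in> space P" for p
  proof -
    have [measurable]: "(\<lambda>z. e z p) \<in> borel_measurable \<mu>"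
      by measurable
    have "(\<integral>\<^sup>+ y. ennreal \<bar>g p y\<bar> \<partial>(\<mu> \<Otimes>\<^sub>M \<mu>))
        = (\<integral>\<^sup>+ z. \<integral>\<^sup>+ z'. ennreal \<bar>e z p\<bar> * ennreal \<bar>e z' p\<bar> \<partial>\<mu> \<partial>\<mu>)"
      by (subst mu.nn_integral_fst [symmetric]) (simp_all add: g_def abs_mult ennreal_mult)
    also have "\<dots> = (\<integral>\<^sup>+ z. ennreal \<bar>e z p\<bar> \<partial>\<mu>) * (\<integral>\<^sup>+ z. ennreal \<bar>e z p\<bar> \<partial>\<mu>)"
      by (simp add: nn_integral_cmult nn_integral_multc)
    also have "\<dots> \<le> ennreal C * ennreal C"
      using bound [OF p] by (intro mult_mono) auto
    finally show ?thesis .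
  qed
  have g_int: "integrable (P \<Otimes>\<^sub>M (\<mu> \<Otimes>\<^sub>M \<mu>)) (case_prod g)"
  proof (rule integrableI_bounded)
    have "(\<integral>\<^sup>+ x. ennreal (norm (case_prod g x)) \<partial>(P \<Otimes>\<^sub>M (\<mu> \<Otimes>\<^sub>M \<mu>)))
        = (\<integral>\<^sup>+ p. \<integral>\<^sup>+ y. ennreal \<bar>g p y\<bar> \<partial>(\<mu> \<Otimes>\<^sub>M \<mu>) \<partial>P)"
      by (subst mm.P.nn_integral_fst [symmetric]) simp_all
    also have "\<dots> \<le> (\<integral>\<^sup>+ p. ennreal C * ennreal C \<partial>P)"
      by (intro nn_integral_mono inner)
    also have "\<dots> < \<infinity>"
      by (simp add: ennreal_mult_less_top P.emeasure_finite less_top[symmetric] ennreal_mult_eq_top_iff)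
    finally show "(\<integral>\<^sup>+ x. ennreal (norm (case_prod g x)) \<partial>(P \<Otimes>\<^sub>M (\<mu> \<Otimes>\<^sub>M \<mu>))) < \<infinity>" .
  qed measurable
  have K_int: "integrable (\<mu> \<Otimes>\<^sub>M \<mu>) (\<lambda>y. LINT p|P. g p y)"
    using PN.integrable_snd [OF g_int] .
  have square: "(LINT y|(\<mu> \<Otimes>\<^sub>M \<mu>). g p y) = (LINT z|\<mu>. e z p)\<^sup>2" if p [measurable]: "p \<in> space P" for p
  proof -
    have [measurable]: "g p \<in> borel_measurable (\<mu> \<Otimes>\<^sub>M \<mu>)"
      unfolding g_def by measurable
    have gp: "integrable (\<mu> \<Otimes>\<^sub>M \<mu>) (g p)"
      using inner [OF p]
      by (intro integrableI_bounded)
        (auto intro: le_less_trans simp: ennreal_mult_less_top)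
    have "(LINT y|(\<mu> \<Otimes>\<^sub>M \<mu>). g p y) = (LINT z|\<mu>. LINT z'|\<mu>. e z p * e z' p)"
      using mm.integral_fst' [OF gp] by (simp add: g_def)
    then show ?thesis
      by (simp add: power2_eq_square)
  qed
  have "(LINT p|P. (LINT z|\<mu>. e z p)\<^sup>2) = (LINT p|P. LINT y|(\<mu> \<Otimes>\<^sub>M \<mu>). g p y)"
    by (intro Bochner_Integration.integral_cong) (simp_all add: square)
  also have "\<dots> = (LINT y|(\<mu> \<Otimes>\<^sub>M \<mu>). LINT p|P. g p y)"
    using PN.Fubini_integral [OF g_int] by simp
  also have "\<dots> = (LINT z|\<mu>. LINT z'|\<mu>. LINT p|P. e z p * e z' p)"
    using mm.integral_fst' [OF K_int] by (simp add: g_def)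
  finally show "(LINT p|P. (LINT z|\<mu>. e z p)\<^sup>2)
    = (LINT z|\<mu>. LINT z'|\<mu>. LINT p|P. e z p * e z' p)" .
  show "integrable \<mu> (\<lambda>z. LINT z'|\<mu>. LINT p|P. e z p * e z' p)"
    using mm.integrable_fst' [OF K_int] by (simp add: g_def)
qed

lemma second_moment_le_L1_norm:
  fixes d :: "'a \<Rightarrow> 'b \<Rightarrow> real"
  assumes "sigma_finite_measure \<mu>" and "finite_measure P"
    and d [measurable]: "(\<lambda>(z, p). d z p) \<in> borel_measurable (\<mu> \<Otimes>\<^sub>M P)"
    and bound: "\<And>p. p \<in> space P \<Longrightarrow> (\<integral>\<^sup>+ z. ennreal \<bar>d z p\<bar> \<partial>\<mu>) \<le> ennreal C"
    and f [measurable]: "f \<in> borel_measurable \<mu>"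
    and f_le: "\<And>z. z \<in> space \<mu> \<Longrightarrow> \<bar>f z\<bar> \<le> 1"
  shows "ennreal (LINT p|P. (LINT z|\<mu>. f z * d z p)\<^sup>2)
    \<le> L1_norm \<mu> (\<lambda>z. LINT z'|\<mu>. (LINT p|P. d z p * d z' p) * f z')"
proof -
  define S where "S = (\<lambda>z. LINT z'|\<mu>. (LINT p|P. d z p * d z' p) * f z')"
  have e_meas: "(\<lambda>(z, p). f z * d z p) \<in> borel_measurable (\<mu> \<Otimes>\<^sub>M P)"
    by measurable
  have e_bound: "(\<integral>\<^sup>+ z. ennreal \<bar>f z * d z p\<bar> \<partial>\<mu>) \<le> ennreal C" if "p \<in> space P" for p
  proof -
    have "(\<integral>\<^sup>+ z. ennreal \<bar>f z * d z p\<bar> \<partial>\<mu>) \<le> (\<integral>\<^sup>+ z. ennreal \<bar>d z p\<bar> \<partial>\<mu>)"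
      by (intro nn_integral_mono ennreal_leI) (simp add: abs_mult mult_left_le_one_le f_le)
    with bound [OF that] show ?thesis
      by (rule order_trans [rotated])
  qed
  have quad: "(LINT z'|\<mu>. LINT p|P. (f z * d z p) * (f z' * d z' p)) = f z * S z" for z
  proof -
    have "(LINT p|P. (f z * d z p) * (f z' * d z' p))
        = f z * ((LINT p|P. d z p * d z' p) * f z')" for z'
    proof -
      have "(LINT p|P. (f z * d z p) * (f z' * d z' p))
          = (LINT p|P. (f z * f z') * (d z p * d z' p))"
        by (simp add: mult_ac)
      then show ?thesis
        by (simp only: integral_mult_right_zero mult_ac)
    qed
    then show ?thesis
      by (simp add: S_def)
  qed
  note Fub = second_moment_Fubini [OF assms(1,2) e_meas e_bound, unfolded quad]
  have "ennreal (LINT p|P. (LINT z|\<mu>. f z * d z p)\<^sup>2) \<le> ennreal \<bar>LINT z|\<mu>. f z * S z\<bar>"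
    by (intro ennreal_leI) (simp add: Fub(1))
  also have "\<dots> \<le> (\<integral>\<^sup>+ z. ennreal \<bar>f z * S z\<bar> \<partial>\<mu>)"
    using integral_norm_bound_ennreal [OF Fub(2)] by simp
  also have "\<dots> \<le> L1_norm \<mu> S"
    unfolding L1_norm_def
    by (intro nn_integral_mono ennreal_leI) (simp add: abs_mult mult_left_le_one_le f_le)
  finally show ?thesis
    by (simp add: S_def)
qed

theorem theorem2:
  fixes \<mu> :: "'a measure"
    and P :: "('a \<times> 'a) measure"
    and Q :: "'a \<Rightarrow> 'a measure"
    and q :: "'a \<Rightarrow> 'a \<Rightarrow> real"
    and A :: "'a \<Rightarrow> real"
  assumes base: "sigma_finite_measure \<mu>"
    and P_prob: "prob_space P"
    and P_sets: "sets P = sets (\<mu> \<Otimes>\<^sub>M \<mu>)"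
    and channel: "Q \<in> \<mu> \<rightarrow>\<^sub>M prob_algebra \<mu>"
    and q_nonneg: "\<And>w z. w \<in> space \<mu> \<Longrightarrow> z \<in> space \<mu> \<Longrightarrow> 0 \<le> q w z"
    and q_meas: "(\<lambda>(w, z). q w z) \<in> borel_measurable (\<mu> \<Otimes>\<^sub>M \<mu>)"
    and q_density: "\<And>z. z \<in> space \<mu> \<Longrightarrow> Q z = density \<mu> (\<lambda>w. ennreal (q w z))"
    and A_meas: "A \<in> borel_measurable \<mu>"
    and A_range: "A \<in> space \<mu> \<rightarrow> {0..1}"
  shows "ennreal (stability_sq P (ensembled Q A))
    \<le> 1 / 4 * Linf_L1_opnorm \<mu> (channel_operator \<mu> P q)"
proof -
  interpret P: prob_space P by fact
  note [measurable] = q_meas A_meas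
  note [measurable_cong] = P_sets
  have P_space: "space P = space \<mu> \<times> space \<mu>"
    using sets_eq_imp_space_eq [OF P_sets] by (simp add: space_pair_measure)
  define d where "d = (\<lambda>z p. q z (fst p) - q z (snd p))"
  define f where "f = (\<lambda>z. 2 * A z - 1)"
  have f_meas [measurable]: "f \<in> borel_measurable \<mu>"
    unfolding f_def by measurable
  have f_le: "\<bar>f z\<bar> \<le> 1" if "z \<in> space \<mu>" for z
  proof -
    have "A z \<in> {0..1}"
      using A_range that by auto
    then show ?thesis
      by (auto simp: f_def)
  qed
  have d_meas: "(\<lambda>(z, p). d z p) \<in> borel_measurable (\<mu> \<Otimes>\<^sub>M P)"
    unfolding d_def by measurable
  have q_mass: "(\<integral>\<^sup>+ w. ennreal (q w z) \<partial>\<mu>) = 1" if z [measurable]: "z \<in> space \<mu>" for z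
  proof -
    have "Q z \<in> space (prob_algebra \<mu>)"
      using measurable_space [OF channel z] .
    then interpret Qz: prob_space "Q z"
      by (simp add: space_prob_algebra)
    have "emeasure (Q z) (space \<mu>) = 1"
      using Qz.emeasure_space_1 by (simp add: q_density [OF z])
    moreover have "emeasure (Q z) (space \<mu>)
        = (\<integral>\<^sup>+ w. ennreal (q w z) * indicator (space \<mu>) w \<partial>\<mu>)"
      by (simp add: q_density [OF z] emeasure_density)
    moreover have "\<dots> = (\<integral>\<^sup>+ w. ennreal (q w z) \<partial>\<mu>)"
      by (intro nn_integral_cong) simp
    ultimately show ?thesis
      by simp
  qed
  have q_int: "integrable \<mu> (\<lambda>w. q w z)" "(LINT w|\<mu>. q w z) = 1"
    if z [measurable]: "z \<in> space \<mu>" for z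
  proof -
    have [measurable]: "(\<lambda>w. q w z) \<in> borel_measurable \<mu>"
      by measurable
    show "integrable \<mu> (\<lambda>w. q w z)"
      using q_mass [OF z] by (intro integrableI_nonneg) (auto simp: q_nonneg z)
    show "(LINT w|\<mu>. q w z) = 1"
      using q_mass [OF z] by (subst integral_eq_nn_integral) (auto simp: q_nonneg z)
  qed
  have Aq_int: "integrable \<mu> (\<lambda>w. A w * q w z)" if z [measurable]: "z \<in> space \<mu>" for z
  proof (rule Bochner_Integration.integrable_bound [OF q_int(1) [OF z]])
    show "(\<lambda>w. A w * q w z) \<in> borel_measurable \<mu>"
      by measurable
    show "AE w in \<mu>. norm (A w * q w z) \<le> norm (q w z)"
    proof (rule AE_I2)
      fix w assume "w \<in> space \<mu>"
      then have "A w \<in> {0..1}"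
        using A_range by auto
      then show "norm (A w * q w z) \<le> norm (q w z)"
        by (simp add: abs_mult mult_left_le_one_le)
    qed
  qed
  have ens: "ensembled Q A z = (LINT w|\<mu>. A w * q w z)" if z [measurable]: "z \<in> space \<mu>" for z
    unfolding ensembled_def q_density [OF z]
    by (subst integral_density) (auto simp: q_nonneg z mult.commute)
  have d_bound: "(\<integral>\<^sup>+ z. ennreal \<bar>d z p\<bar> \<partial>\<mu>) \<le> ennreal 2" if "p \<in> space P" for p
  proof -
    from that have [measurable]: "fst p \<in> space \<mu>" "snd p \<in> space \<mu>"
      by (auto simp: P_space)
    have "(\<integral>\<^sup>+ z. ennreal \<bar>d z p\<bar> \<partial>\<mu>)
        \<le> (\<integral>\<^sup>+ z. ennreal (q z (fst p)) + ennreal (q z (snd p)) \<partial>\<mu>)"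
    proof (rule nn_integral_mono)
      fix z assume "z \<in> space \<mu>"
      then have "0 \<le> q z (fst p)" "0 \<le> q z (snd p)"
        by (simp_all add: q_nonneg \<open>fst p \<in> space \<mu>\<close> \<open>snd p \<in> space \<mu>\<close>)
      then show "ennreal \<bar>d z p\<bar> \<le> ennreal (q z (fst p)) + ennreal (q z (snd p))"
        by (simp add: d_def ennreal_leI flip: ennreal_plus)
    qed
    also have "\<dots> = 2"
      by (subst nn_integral_add) (simp_all add: q_mass \<open>fst p \<in> space \<mu>\<close> \<open>snd p \<in> space \<mu>\<close>)
    finally show ?thesis
      by simp
  qed
  \<comment> \<open>Here \<open>A = (1 + f) / 2\<close>, and the constant contributes nothing because \<open>d\<close> integrates to 0.\<close>
  have diff: "ensembled Q A (fst p) - ensembled Q A (snd p) = 1 / 2 * (LINT z|\<mu>. f z * d z p)"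
    if "p \<in> space P" for p
  proof -
    from that have p: "fst p \<in> space \<mu>" "snd p \<in> space \<mu>"
      by (auto simp: P_space)
    have "(LINT z|\<mu>. f z * d z p) = (LINT z|\<mu>. 2 * (A z * q z (fst p)) - 2 * (A z * q z (snd p))
        - (q z (fst p) - q z (snd p)))"
      by (simp add: f_def d_def algebra_simps)
    also have "\<dots> = 2 * ensembled Q A (fst p) - 2 * ensembled Q A (snd p)"
      using p by (simp add: ens Aq_int q_int)
    finally show ?thesis
      by simp
  qed
  have "stability_sq P (ensembled Q A)
      = (LINT p|P. 1 / 4 * (LINT z|\<mu>. f z * d z p)\<^sup>2)"
    unfolding stability_sq_def
    by (intro Bochner_Integration.integral_cong)
      (simp_all add: case_prod_beta diff power2_eq_square)
  then have "ennreal (stability_sq P (ensembled Q A))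
      = ennreal (1 / 4) * ennreal (LINT p|P. (LINT z|\<mu>. f z * d z p)\<^sup>2)"
    by (simp only: integral_mult_right_zero) (rule ennreal_mult', simp)
  also have "ennreal (1 / 4) = 1 / 4"
    using divide_ennreal [of 1 4] by simp
  also have "ennreal (LINT p|P. (LINT z|\<mu>. f z * d z p)\<^sup>2)
      \<le> L1_norm \<mu> (channel_operator \<mu> P q f)"
    using second_moment_le_L1_norm [OF base P.finite_measure_axioms d_meas d_bound f_meas f_le]
    by (simp add: channel_operator_def [abs_def] channel_kernel_def case_prod_unfold d_def)
  also have "L1_norm \<mu> (channel_operator \<mu> P q f) \<le> Linf_L1_opnorm \<mu> (channel_operator \<mu> P q)"
    unfolding Linf_L1_opnorm_def
    by (intro SUP_upper) (auto simp: Linf_norm_def f_le intro!: SUP_least)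
  finally show ?thesis
    by (simp add: mult_left_mono)
qed

end
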